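(* Let $m\geq 4$ be an integer and let $\gamma$ be a full $4$-Frenet helix in the unit Euclidean sphere $\mathbb{S}^m$. Then $\gamma$ is not $r$-harmonic for $r=4$ and for $r=5$.
   Context: $\mathbb{S}^m$ is the unit sphere (constant curvature $1$), oriented, with Levi-Civita connection $\nabla$ and curvature $R(X,Y)Z=\langle Y,Z\rangle X-\langle X,Z\rangle Y$. Curves $\gamma:I\to \mathbb{S}^m$ ($I\subset\mathbb{R}$ an interval) are smooth and parametrized by arc length, with unit tangent $T=\gamma'$. Put $\nabla^0_TT=T$, $\nabla_T^kT=\nabla_T(\nabla_T^{k-1}T)$. For an integer $r\ge2$, $\gamma$ is $r$-harmonic if \[ \tau_r(\gamma)=\nabla^{2r-1}_T T+ \sum_{\ell=0}^{r-2}(-1)^\ell R\left (\nabla^{2r-3-\ell}_T T ,\nabla^{\ell}_T T\right )T=0 . \] A $4$-Frenet helix is such a curve admitting an orthonormal field $\{F_1,F_2,F_3,F_4\}$ along $\gamma$ with $F_1=T$, $\nabla_TF_1=\kappa_1F_2$, $\nabla_TF_2=-\kappa_1F_1+\kappa_2F_3$, $\nabla_TF_3=-\kappa_2F_2+\kappa_3F_4$, $\nabla_TF_4=-\kappa_3F_3$, where $\kappa_1,\kappa_2,\kappa_3$ are positive constants; in the special case $m=4$ the frame is instead chosen positively oriented and $\kappa_3$ is allowed to be any real constant. It is full if $\kappa_3\neq0$. *)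

theory Defs
  imports "HOL-Analysis.Analysis"
begin

text \<open>
  The sphere \<open>S\<^sup>m\<close> is \<open>sphere 0 1\<close> in \<open>real ^ 'n\<close> with \<open>CARD('n) = m + 1\<close>; a curve in it is a map
  \<open>real \<Rightarrow> real ^ 'n\<close> of which only the values on the interval \<open>I\<close> matter. Derivatives are taken
  within \<open>I\<close>, hence they are one-sided at those end points of \<open>I\<close> that belong to \<open>I\<close>.
\<close>

definition deriv_within :: "real set \<Rightarrow> (real \<Rightarrow> 'a::real_normed_vector) \<Rightarrow> real \<Rightarrow> 'a" where
  "deriv_within I f t = vector_derivative f (at t within I)"

definition smooth_on :: "real set \<Rightarrow> (real \<Rightarrow> 'a::real_normed_vector) \<Rightarrow> bool" where
  "smooth_on I f \<longleftrightarrow> (\<forall>k. \<forall>t\<in>I. (deriv_within I ^^ k) f differentiable (at t within I))"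

definition nondegenerate_interval :: "real set \<Rightarrow> bool" where
  "nondegenerate_interval I \<longleftrightarrow> is_interval I \<and> interior I \<noteq> {}"

definition unit_speed_sphere_curve :: "real set \<Rightarrow> (real \<Rightarrow> real ^ 'n) \<Rightarrow> bool" where
  "unit_speed_sphere_curve I \<gamma> \<longleftrightarrow>
     nondegenerate_interval I \<and> smooth_on I \<gamma> \<and>
     (\<forall>t\<in>I. \<gamma> t \<in> sphere 0 1) \<and> (\<forall>t\<in>I. norm (deriv_within I \<gamma> t) = 1)"

definition sphere_tangent_space :: "real ^ 'n \<Rightarrow> (real ^ 'n) set" where
  "sphere_tangent_space p = {v. v \<bullet> p = 0}"

definition tangent_projection :: "real ^ 'n \<Rightarrow> real ^ 'n \<Rightarrow> real ^ 'n" where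
  "tangent_projection p v = v - (v \<bullet> p) *\<^sub>R p"

text \<open>
  The Levi-Civita connection of a submanifold of Euclidean space is the tangential part of the
  flat derivative; this is the induced covariant derivative of a vector field \<open>V\<close> along \<open>\<gamma>\<close>.
\<close>

definition covariant_deriv ::
    "real set \<Rightarrow> (real \<Rightarrow> real ^ 'n) \<Rightarrow> (real \<Rightarrow> real ^ 'n) \<Rightarrow> real \<Rightarrow> real ^ 'n" where
  "covariant_deriv I \<gamma> V t = tangent_projection (\<gamma> t) (deriv_within I V t)"

definition nabla_T_pow ::
    "real set \<Rightarrow> (real \<Rightarrow> real ^ 'n) \<Rightarrow> nat \<Rightarrow> real \<Rightarrow> real ^ 'n" where
  "nabla_T_pow I \<gamma> k = (covariant_deriv I \<gamma> ^^ k) (deriv_within I \<gamma>)"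

definition sphere_curvature :: "real ^ 'n \<Rightarrow> real ^ 'n \<Rightarrow> real ^ 'n \<Rightarrow> real ^ 'n" where
  "sphere_curvature X Y Z = (Y \<bullet> Z) *\<^sub>R X - (X \<bullet> Z) *\<^sub>R Y"

text \<open>Meant for \<open>r \<ge> 2\<close>; then none of the subtractions on \<open>nat\<close> truncates.\<close>

definition r_tension :: "nat \<Rightarrow> real set \<Rightarrow> (real \<Rightarrow> real ^ 'n) \<Rightarrow> real \<Rightarrow> real ^ 'n" where
  "r_tension r I \<gamma> t =
     nabla_T_pow I \<gamma> (2 * r - 1) t +
     (\<Sum>l = 0..r - 2. (- 1) ^ l *\<^sub>R
        sphere_curvature (nabla_T_pow I \<gamma> (2 * r - 3 - l) t) (nabla_T_pow I \<gamma> l t)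
          (deriv_within I \<gamma> t))"

definition r_harmonic :: "nat \<Rightarrow> real set \<Rightarrow> (real \<Rightarrow> real ^ 'n) \<Rightarrow> bool" where
  "r_harmonic r I \<gamma> \<longleftrightarrow> (\<forall>t\<in>I. r_tension r I \<gamma> t = 0)"

text \<open>
  An orientation is fixed by an enumeration \<open>e\<close> of the coordinates, declaring the basis
  \<open>axis (e 0) 1, axis (e 1) 1, \<dots>\<close> positive. A basis \<open>v 1, \<dots>, v m\<close> of the tangent space of
  \<open>S\<^sup>m\<close> at \<open>p\<close> is positive if \<open>p, v 1, \<dots>, v m\<close> is (outward normal first). The matrix below has
  \<open>p\<close> in row \<open>e 0\<close> and \<open>v k\<close> in row \<open>e k\<close>.
\<close>

definition enumeration :: "(nat \<Rightarrow> 'n::finite) \<Rightarrow> bool" where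
  "enumeration e \<longleftrightarrow> bij_betw e {..<CARD('n)} UNIV"

definition positively_oriented ::
    "(nat \<Rightarrow> 'n::finite) \<Rightarrow> real ^ 'n \<Rightarrow> (nat \<Rightarrow> real ^ 'n) \<Rightarrow> bool" where
  "positively_oriented e p v \<longleftrightarrow>
     det (\<chi> i. let k = inv_into {..<CARD('n)} e i in if k = 0 then p else v k) > 0"

definition orthonormal_tangent_fields4 ::
    "real set \<Rightarrow> (real \<Rightarrow> real ^ 'n) \<Rightarrow> (nat \<Rightarrow> real \<Rightarrow> real ^ 'n) \<Rightarrow> bool" where
  "orthonormal_tangent_fields4 I \<gamma> F \<longleftrightarrow>
     (\<forall>i\<in>{1..4}. smooth_on I (F i)) \<and>
     (\<forall>t\<in>I. \<forall>i\<in>{1..4}. F i t \<in> sphere_tangent_space (\<gamma> t)) \<and>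
     (\<forall>t\<in>I. \<forall>i\<in>{1..4}. \<forall>j\<in>{1..4}. F i t \<bullet> F j t = (if i = j then 1 else 0))"

text \<open>The condition \<open>CARD('n) = 5\<close> is the special case \<open>m = 4\<close>.\<close>

definition frenet_helix4_with ::
    "(nat \<Rightarrow> 'n::finite) \<Rightarrow> real set \<Rightarrow> (real \<Rightarrow> real ^ 'n) \<Rightarrow> (nat \<Rightarrow> real \<Rightarrow> real ^ 'n) \<Rightarrow>
     real \<Rightarrow> real \<Rightarrow> real \<Rightarrow> bool" where
  "frenet_helix4_with e I \<gamma> F \<kappa>\<^sub>1 \<kappa>\<^sub>2 \<kappa>\<^sub>3 \<longleftrightarrow>
     unit_speed_sphere_curve I \<gamma> \<and>
     orthonormal_tangent_fields4 I \<gamma> F \<and>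
     \<kappa>\<^sub>1 > 0 \<and> \<kappa>\<^sub>2 > 0 \<and>
     (if CARD('n) = 5 then \<forall>t\<in>I. positively_oriented e (\<gamma> t) (\<lambda>k. F k t) else \<kappa>\<^sub>3 > 0) \<and>
     (\<forall>t\<in>I.
        F 1 t = deriv_within I \<gamma> t \<and>
        covariant_deriv I \<gamma> (F 1) t = \<kappa>\<^sub>1 *\<^sub>R F 2 t \<and>
        covariant_deriv I \<gamma> (F 2) t = - \<kappa>\<^sub>1 *\<^sub>R F 1 t + \<kappa>\<^sub>2 *\<^sub>R F 3 t \<and>
        covariant_deriv I \<gamma> (F 3) t = - \<kappa>\<^sub>2 *\<^sub>R F 2 t + \<kappa>\<^sub>3 *\<^sub>R F 4 t \<and>
        covariant_deriv I \<gamma> (F 4) t = - \<kappa>\<^sub>3 *\<^sub>R F 3 t)"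

definition full_frenet_helix4 ::
    "(nat \<Rightarrow> 'n::finite) \<Rightarrow> real set \<Rightarrow> (real \<Rightarrow> real ^ 'n) \<Rightarrow> bool" where
  "full_frenet_helix4 e I \<gamma> \<longleftrightarrow>
     (\<exists>F \<kappa>\<^sub>1 \<kappa>\<^sub>2 \<kappa>\<^sub>3. frenet_helix4_with e I \<gamma> F \<kappa>\<^sub>1 \<kappa>\<^sub>2 \<kappa>\<^sub>3 \<and> \<kappa>\<^sub>3 \<noteq> 0)"

end

theory Submission
  imports Defs
begin

text \<open>
  The Frenet equations make \<open>\<nabla>\<^sub>T\<close> act on the constant-coefficient span of the frame by a skew
  \<open>4 \<times> 4\<close> matrix \<open>A\<close>, so the tension field becomes a polynomial in \<open>A\<close> applied to \<open>F\<^sub>1\<close>. Put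
  \<open>a = \<kappa>\<^sub>1\<^sup>2\<close>, \<open>s = \<kappa>\<^sub>1\<^sup>2 + \<kappa>\<^sub>2\<^sup>2 + \<kappa>\<^sub>3\<^sup>2\<close> and \<open>p = \<kappa>\<^sub>1\<^sup>2 \<kappa>\<^sub>3\<^sup>2\<close>; then \<open>A\<^sup>4 = - s A\<^sup>2 - p\<close> by
  Cayley--Hamilton, and the tension is a combination of \<open>A F\<^sub>1\<close> and \<open>A\<^sup>3 F\<^sub>1\<close>, which are linearly
  independent. Its vanishing amounts to two polynomial equations in \<open>a, s, p\<close>, and they are
  incompatible with \<open>a (s - a) - p = \<kappa>\<^sub>1\<^sup>2 \<kappa>\<^sub>2\<^sup>2 > 0\<close>.
\<close>

text \<open>This makes derivatives within \<open>I\<close> unique, also at the end points of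
  \<open>I\<close>.\<close>

lemma at_within_nondegenerate_interval_neq_bot:
  assumes "nondegenerate_interval I" "t \<in> I"
  shows "at t within I \<noteq> bot"
proof
  assume "at t within I = bot"
  then have "\<not> t islimpt I"
    by (simp add: trivial_limit_within)
  moreover have "connected I"
    using assms(1) by (simp add: nondegenerate_interval_def is_interval_connected)
  ultimately have "I = {t}"
    using assms(2) connected_imp_perfect by blast
  then show False
    using assms(1) by (simp add: nondegenerate_interval_def)
qed

text \<open>The derivative within \<open>I\<close> sees only values on \<open>I\<close>, and both it
  and the projection at \<gamma> t are linear over constants.\<close>

lemma covariant_deriv_sum_scaleR:
  fixes F :: "'i \<Rightarrow> real \<Rightarrow> real ^ 'n"
  assumes "nondegenerate_interval I" "t \<in> I"
    and F: "\<And>i. i \<in> S \<Longrightarrow> smooth_on I (F i)"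
    and V: "\<And>u. u \<in> I \<Longrightarrow> V u = (\<Sum>i\<in>S. x i *\<^sub>R F i u)"
  shows "covariant_deriv I \<gamma> V t = (\<Sum>i\<in>S. x i *\<^sub>R covariant_deriv I \<gamma> (F i) t)"
proof -
  have "(F i has_vector_derivative deriv_within I (F i) t) (at t within I)" if "i \<in> S" for i
  proof -
    have "((deriv_within I ^^ 0) (F i)) differentiable (at t within I)"
      using F[OF that] assms(2) unfolding smooth_on_def by blast
    then show ?thesis
      by (simp add: deriv_within_def vector_derivative_works)
  qed
  then have "((\<lambda>u. \<Sum>i\<in>S. x i *\<^sub>R F i u) has_vector_derivative
      (\<Sum>i\<in>S. x i *\<^sub>R deriv_within I (F i) t)) (at t within I)"
    by (intro has_vector_derivative_sum)
       (auto simp: has_vector_derivative_def scaleR_left_commute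
          intro!: derivative_eq_intros)
  then have "(V has_vector_derivative (\<Sum>i\<in>S. x i *\<^sub>R deriv_within I (F i) t)) (at t within I)"
    by (rule has_vector_derivative_transform[OF assms(2), rotated]) (simp add: V)
  then have "deriv_within I V t = (\<Sum>i\<in>S. x i *\<^sub>R deriv_within I (F i) t)"
    unfolding deriv_within_def
    using vector_derivative_within[OF at_within_nondegenerate_interval_neq_bot[OF assms(1,2)]]
    by blast
  then show ?thesis
    by (simp add: covariant_deriv_def tangent_projection_def scaleR_diff_right inner_sum_left
        sum_subtractf scaleR_sum_left)
qed

text \<open>The frame coordinates of A^k F_1, indexed by 1 to 4 as in the Frenet equations.\<close>

primrec frenet_coeff :: "real \<Rightarrow> real \<Rightarrow> real \<Rightarrow> nat \<Rightarrow> nat \<Rightarrow> real" where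
  "frenet_coeff a b c 0 = (\<lambda>i. if i = 1 then 1 else 0)"
| "frenet_coeff a b c (Suc k) = (\<lambda>i.
     if i = 1 then - a * frenet_coeff a b c k 2
     else if i = 2 then a * frenet_coeff a b c k 1 - b * frenet_coeff a b c k 3
     else if i = 3 then b * frenet_coeff a b c k 2 - c * frenet_coeff a b c k 4
     else c * frenet_coeff a b c k 3)"

lemma sum_1_to_4: "(\<Sum>i\<in>{1..4::nat}. f i) = f 1 + f 2 + f 3 + (f 4 :: 'a::comm_monoid_add)"
proof -
  have "{1..4::nat} = {1,2,3,4}"
    by auto
  then show ?thesis
    by (simp add: add.assoc)
qed

text \<open>Cayley-Hamilton, read off coordinatewise.\<close>

lemma frenet_coeff_add_4:
  assumes "i \<in> {1..4}"
  shows "frenet_coeff a b c (k + 4) i =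
    - (a\<^sup>2 + b\<^sup>2 + c\<^sup>2) * frenet_coeff a b c (k + 2) i - a\<^sup>2 * c\<^sup>2 * frenet_coeff a b c k i"
proof -
  have "i = 1 \<or> i = 2 \<or> i = 3 \<or> i = 4"
    using assms by auto
  then show ?thesis
    by (elim disjE) (simp_all add: eval_nat_numeral algebra_simps)
qed

lemma nabla_T_pow_frenet:
  assumes "frenet_helix4_with e I \<gamma> F a b c" "t \<in> I"
  shows "nabla_T_pow I \<gamma> k t = (\<Sum>i\<in>{1..4}. frenet_coeff a b c k i *\<^sub>R F i t)"
  using assms(2)
\<comment> \<open>Differentiating at one point needs the expansion on all of \<open>I\<close>, hence
  the generalised \<open>t\<close>.\<close>
proof (induction k arbitrary: t)
  case 0
  then show ?case
    using assms(1) by (simp add: nabla_T_pow_def frenet_helix4_with_def sum_1_to_4 del: One_nat_def)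
next
  case (Suc k)
  have "nondegenerate_interval I" "\<And>i. i \<in> {1..4} \<Longrightarrow> smooth_on I (F i)"
    using assms(1) by (auto simp: frenet_helix4_with_def unit_speed_sphere_curve_def
        orthonormal_tangent_fields4_def)
  then have "covariant_deriv I \<gamma> (nabla_T_pow I \<gamma> k) t =
      (\<Sum>i\<in>{1..4}. frenet_coeff a b c k i *\<^sub>R covariant_deriv I \<gamma> (F i) t)"
    using Suc by (intro covariant_deriv_sum_scaleR)
  moreover have "nabla_T_pow I \<gamma> (Suc k) = covariant_deriv I \<gamma> (nabla_T_pow I \<gamma> k)"
    by (simp add: nabla_T_pow_def)
  ultimately show ?case
    using assms(1) Suc.prems unfolding frenet_helix4_with_def sum_1_to_4
    by (simp add: algebra_simps)
qed

text \<open>Since F_1 = T, the inner products with T in the curvature terms are first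
  coordinates.\<close>

lemma r_tension_inner_frenet:
  assumes helix: "frenet_helix4_with e I \<gamma> F a b c" and "t \<in> I" "i \<in> {1..4}"
  defines "x \<equiv> frenet_coeff a b c"
  shows "r_tension r I \<gamma> t \<bullet> F i t = x (2 * r - 1) i +
    (\<Sum>l = 0..r - 2. (- 1) ^ l * (x l 1 * x (2 * r - 3 - l) i - x (2 * r - 3 - l) 1 * x l i))"
proof -
  have orth: "F i t \<bullet> F j t = (if i = j then 1 else 0)" if "i \<in> {1..4}" "j \<in> {1..4}" for i j
    using helix assms(2) that by (auto simp: frenet_helix4_with_def orthonormal_tangent_fields4_def)
  have T: "deriv_within I \<gamma> t = F 1 t"
    using helix assms(2) by (simp add: frenet_helix4_with_def)
  have "nabla_T_pow I \<gamma> k t \<bullet> F j t = x k j" if "j \<in> {1..4}" for j k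
  proof -
    have "nabla_T_pow I \<gamma> k t \<bullet> F j t = (\<Sum>i\<in>{1..4}. x k i * (F i t \<bullet> F j t))"
      by (simp add: nabla_T_pow_frenet[OF helix assms(2)] inner_sum_left x_def)
    also have "\<dots> = (\<Sum>i\<in>{1..4}. if i = j then x k i else 0)"
      using that by (intro sum.cong) (auto simp: orth)
    finally show ?thesis
      using that by simp
  qed
  then show ?thesis
    using assms(3) by (simp add: r_tension_def sphere_curvature_def T inner_add_left
        inner_sum_left inner_diff_left)
qed

text \<open>Adding \<open>s\<close> times the first equation to the second eliminates
  \<open>a\<close> and forces \<open>s > 1\<close>. The gap gives \<open>s * a > p\<close>, so the
  second equation forces \<open>s < 1\<close>.\<close>

lemma not_4_harmonic_equations:
  fixes a s p :: real
  assumes "a > 0" "p > 0" and gap: "a * (s - a) > p"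
    and eqs: "s\<^sup>2 - p = s + a" "s * p - 2 * p + s * a = 0"
  shows False
proof -
  have "s * (s\<^sup>2 - p - s - a) = 0"
    using eqs(1) by simp
  then have "s\<^sup>2 * (s - 1) = 2 * p"
    using eqs(2) by (simp add: algebra_simps power2_eq_square)
  then have "s > 1"
    using \<open>p > 0\<close> by (smt (verit) mult_nonneg_nonpos zero_le_power2)
  have "a * (s - a) \<le> s * a"
    by (simp add: algebra_simps)
  then have "s * p < p"
    using gap eqs(2) by linarith
  then show False
    using \<open>p > 0\<close> \<open>s > 1\<close> by simp
qed

text \<open>
  The equations are homogenised by \<open>p = k s\<^sup>2\<close> and \<open>a = h s\<close>; both \<open>s\<close> and \<open>h\<close> are then rational
  functions of \<open>k\<close>, where \<open>0 < k < 1/4\<close>.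
\<close>

lemma not_5_harmonic_equations:
  fixes a s p :: real
  assumes "a > 0" "p > 0" and gap: "a * (s - a) > p"
    and eqs: "s ^ 3 - 2 * s * p = s\<^sup>2 - 2 * p + 2 * a * s"
      "p * (p - s\<^sup>2 + 2 * s) = a * (s\<^sup>2 - 2 * p)"
  shows False
proof -
  have "a * (s - a) > 0"
    using assms(2) gap by linarith
  then have "s > 0"
    using \<open>a > 0\<close> by (simp add: zero_less_mult_iff)
  define k h where "k = p / s\<^sup>2" and "h = a / s"
  have p: "p = k * s\<^sup>2" and a: "a = h * s"
    using \<open>s > 0\<close> by (simp_all add: k_def h_def)
  have "k > 0"
    using \<open>s > 0\<close> \<open>p > 0\<close> by (simp add: k_def)
  have "s\<^sup>2 * (h * (1 - h)) > s\<^sup>2 * k"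
    using gap by (simp add: p a algebra_simps power2_eq_square)
  then have gap': "h * (1 - h) > k"
    using \<open>s > 0\<close> by simp
  \<comment> \<open>The resulting bound on \<open>k\<close> gives the positivity of \<open>N\<close>
    and of the cubic factor at the end.\<close>
  have "h * (1 - h) \<le> 1 / 4"
    using zero_le_square[of "h - 1 / 2"] by (simp add: algebra_simps)
  then have "k < 1 / 4"
    using gap' by linarith
  have "s\<^sup>2 * ((s - 1) * (1 - 2 * k)) = s\<^sup>2 * (2 * h)"
    using eqs(1) by (simp add: p a algebra_simps power2_eq_square power3_eq_cube)
  then have h: "2 * h = (s - 1) * (1 - 2 * k)"
    using \<open>s > 0\<close> by simp
  have "s ^ 3 * (k * (s * k - s + 2)) = s ^ 3 * (h * (1 - 2 * k))"
    using eqs(2) by (simp add: p a algebra_simps power2_eq_square power3_eq_cube)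
  then have "k * (s * k - s + 2) = h * (1 - 2 * k)"
    using \<open>s > 0\<close> by simp
  then have "2 * (k * (s * k - s + 2)) = (s - 1) * (1 - 2 * k) * (1 - 2 * k)"
    using h by (metis mult.assoc)
  \<comment> \<open>Eliminating \<open>h\<close> leaves an equation linear in \<open>s - 1\<close>;
    \<open>N\<close> is its leading coefficient, the common denominator of \<open>s - 1\<close> and
    \<open>h\<close>.\<close>
  moreover define N where "N = 1 - 2 * k + 2 * k\<^sup>2"
  ultimately have "(s - 1) * N = 2 * (k + k\<^sup>2)"
    by (simp add: N_def algebra_simps power2_eq_square)
  then have hN: "h * N = (k + k\<^sup>2) * (1 - 2 * k)"
    using h by algebra
  have "N > 0"
    using \<open>k < 1 / 4\<close> zero_le_power2[of k] unfolding N_def by linarith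
  then have "h * (1 - h) * N\<^sup>2 > k * N\<^sup>2"
    using gap' by simp
  moreover have "h * (1 - h) * N\<^sup>2 - k * N\<^sup>2 = h * N * (N - h * N) - k * N\<^sup>2"
    by algebra
  \<comment> \<open>The terms of order k and k^2 cancel, so the sign is decided at order
    k^3.\<close>
  moreover have "\<dots> = - (k ^ 3 * (4 - 13 * k + 12 * k\<^sup>2 + 4 * k ^ 3))"
    unfolding hN unfolding N_def by algebra
  moreover have "4 - 13 * k + 12 * k\<^sup>2 + 4 * k ^ 3 > 0"
    using \<open>k < 1 / 4\<close> \<open>k > 0\<close> zero_less_power[of k 2] zero_less_power[of k 3] by linarith
  ultimately show False
    using \<open>k > 0\<close> by (smt (verit) mult_pos_pos zero_less_power)
qed

theorem theorem5p2:
  fixes m :: nat and e :: "nat \<Rightarrow> 'n::finite" and I :: "real set"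
    and \<gamma> :: "real \<Rightarrow> real ^ 'n"
  assumes "m \<ge> 4"
    and "CARD('n) = m + 1"
    and "enumeration e"
    and "full_frenet_helix4 e I \<gamma>"
  shows "\<not> r_harmonic 4 I \<gamma> \<and> \<not> r_harmonic 5 I \<gamma>"
proof -
  \<comment> \<open>For m = 4 the curvature \<open>c\<close> may be negative;
    \<open>c \<noteq> 0\<close> covers both signs.\<close>
  obtain F a b c where helix: "frenet_helix4_with e I \<gamma> F a b c" and "c \<noteq> 0"
    using assms(4) unfolding full_frenet_helix4_def by blast
  have "a \<noteq> 0" "b \<noteq> 0"
    using helix by (auto simp: frenet_helix4_with_def)
  have "I \<noteq> {}"
    using helix by (auto simp: frenet_helix4_with_def unit_speed_sphere_curve_def
        nondegenerate_interval_def)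
  then obtain t where "t \<in> I"
    by blast
  define x where "x = frenet_coeff a b c"
  define s where "s = a\<^sup>2 + b\<^sup>2 + c\<^sup>2"
  define p where "p = a\<^sup>2 * c\<^sup>2"
  have "a\<^sup>2 > 0" "p > 0"
    using \<open>a \<noteq> 0\<close> \<open>c \<noteq> 0\<close> by (simp_all add: p_def)
  have "a\<^sup>2 * (s - a\<^sup>2) - p = a\<^sup>2 * b\<^sup>2"
    by (simp add: s_def p_def algebra_simps)
  moreover have "a\<^sup>2 * b\<^sup>2 > 0"
    using \<open>a \<noteq> 0\<close> \<open>b \<noteq> 0\<close> by simp
  ultimately have gap: "a\<^sup>2 * (s - a\<^sup>2) > p"
    by linarith
  have rec: "x (k + 4) i = - s * x (k + 2) i - p * x k i" if "i \<in> {1..4}" for k i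
    using frenet_coeff_add_4[OF that] by (simp add: x_def s_def p_def)
  have x0: "x 0 1 = 1" "x 0 2 = 0" "x 0 3 = 0" "x 0 4 = 0"
    by (simp_all add: x_def)
  have x1: "x 1 1 = 0" "x 1 2 = a" "x 1 3 = 0" "x 1 4 = 0"
    by (simp_all add: x_def)
  have x2: "x 2 1 = - a\<^sup>2" "x 2 2 = 0" "x 2 3 = a * b" "x 2 4 = 0"
    by (simp_all add: x_def eval_nat_numeral)
  have x3: "x 3 1 = 0" "x 3 2 = - a * (a\<^sup>2 + b\<^sup>2)" "x 3 4 = a * b * c"
    by (simp_all add: x_def eval_nat_numeral algebra_simps)
  have x4: "x 4 i = - s * x 2 i - p * x 0 i" if "i \<in> {1..4}" for i
    using rec[OF that, of 0] by (simp del: add_2_eq_Suc add_2_eq_Suc')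
  have x5: "x 5 i = - s * x 3 i - p * x 1 i" if "i \<in> {1..4}" for i
    using rec[OF that, of 1] by (simp del: add_2_eq_Suc add_2_eq_Suc')
  have x6: "x 6 i = - s * x 4 i - p * x 2 i" if "i \<in> {1..4}" for i
    using rec[OF that, of 2] by (simp del: add_2_eq_Suc add_2_eq_Suc')
  have x7: "x 7 i = - s * x 5 i - p * x 3 i" if "i \<in> {1..4}" for i
    using rec[OF that, of 3] by (simp del: add_2_eq_Suc add_2_eq_Suc')
  have x9: "x 9 i = - s * x 7 i - p * x 5 i" if "i \<in> {1..4}" for i
    using rec[OF that, of 5] by (simp del: add_2_eq_Suc add_2_eq_Suc')
  note xs = x0 x1 x2 x3 x4 x5 x6 x7 x9
  \<comment> \<open>A F_1 is \<open>a\<close> times F_2, whereas A^3 F_1 has the F_4 coordinate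
    \<open>a * b * c\<close>, nonzero by fullness.\<close>
  have independent: "\<alpha> = 0 \<and> \<beta> = 0"
    if "\<And>i. i \<in> {1..4} \<Longrightarrow> \<alpha> * x 3 i + \<beta> * x 1 i = 0" for \<alpha> \<beta>
  proof -
    have "\<alpha> = 0"
      using that[of 4] \<open>a \<noteq> 0\<close> \<open>b \<noteq> 0\<close> \<open>c \<noteq> 0\<close> by (simp add: xs del: One_nat_def)
    then show ?thesis
      using that[of 2] \<open>a \<noteq> 0\<close> by (simp add: xs del: One_nat_def)
  qed
  have "\<not> r_harmonic 4 I \<gamma>"
  proof
    assume "r_harmonic 4 I \<gamma>"
    then have "x 7 i + (x 0 1 * x 5 i - x 5 1 * x 0 i) - (x 1 1 * x 4 i - x 4 1 * x 1 i)
        + (x 2 1 * x 3 i - x 3 1 * x 2 i) = 0" if "i \<in> {1..4}" for i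
      using r_tension_inner_frenet[OF helix \<open>t \<in> I\<close> that, of 4, folded x_def] \<open>t \<in> I\<close>
      by (simp add: r_harmonic_def atLeast0_atMost_Suc eval_nat_numeral algebra_simps)
    \<comment> \<open>Odd powers of A are skew, so their first coordinates vanish: each bracket
      keeps only a multiple of an odd-indexed term, which the recurrence reduces to
      \<open>x 3\<close> and \<open>x 1\<close>.\<close>
    then have "(s\<^sup>2 - p - (s + a\<^sup>2)) * x 3 i + (s * p - 2 * p + s * a\<^sup>2) * x 1 i = 0"
      if "i \<in> {1..4}" for i
      using that by (simp add: xs algebra_simps power2_eq_square del: One_nat_def)
    from independent[OF this] show False
      using not_4_harmonic_equations[OF \<open>a\<^sup>2 > 0\<close> \<open>p > 0\<close> gap] by simp
  qed
  moreover have "\<not> r_harmonic 5 I \<gamma>"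
  proof
    assume "r_harmonic 5 I \<gamma>"
    then have "x 9 i + (x 0 1 * x 7 i - x 7 1 * x 0 i) - (x 1 1 * x 6 i - x 6 1 * x 1 i)
        + (x 2 1 * x 5 i - x 5 1 * x 2 i) - (x 3 1 * x 4 i - x 4 1 * x 3 i) = 0"
      if "i \<in> {1..4}" for i
      using r_tension_inner_frenet[OF helix \<open>t \<in> I\<close> that, of 5, folded x_def] \<open>t \<in> I\<close>
      by (simp add: r_harmonic_def atLeast0_atMost_Suc eval_nat_numeral algebra_simps)
    then have "(s\<^sup>2 - 2 * p + 2 * a\<^sup>2 * s - (s ^ 3 - 2 * s * p)) * x 3 i
        + (p * (p - s\<^sup>2 + 2 * s) - a\<^sup>2 * (s\<^sup>2 - 2 * p)) * x 1 i = 0"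
      if "i \<in> {1..4}" for i
      using that by (simp add: xs algebra_simps power2_eq_square power3_eq_cube
          del: One_nat_def)
    from independent[OF this] show False
      using not_5_harmonic_equations[OF \<open>a\<^sup>2 > 0\<close> \<open>p > 0\<close> gap] by simp
  qed
  ultimately show ?thesis
    by blast
qed

end
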